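(* The family $\mathfrak{A}^1=\{\mathfrak{A}^1_\alpha\}_{\alpha\le1}$ is a filtration of $\mathcal{G}_0$. Moreover, for any $\alpha\le1$ the following assertions hold: (i) Each function $f_\theta(z)=z+e^{i\theta}z^2$, $\theta\in\mathbb{R}$, belongs to the set $\mathfrak{A}^1_\alpha$ and is totally extremal for it. (ii) Each function $f_{\theta,n,\alpha}(z)=z+\frac{2-\alpha}{1+n(1-\alpha)}e^{i\theta}z^{n+1}$, $\theta\in\mathbb{R}$, $n\in\mathbb{N}\setminus\{1\}$, belongs to $\partial\mathfrak{A}^1_\alpha$. Hence the filtration $\mathfrak{A}^1$ is strict. (iii) $K(\mathfrak{A}^1_\alpha)=0$ and $B(\mathfrak{A}^1_\alpha)=1$.
   Context: Let $\mathbb{D}$ be the open unit disk and $\mathbb{N}=\{1,2,\dots\}$. $\mathcal{A}$ is the set of holomorphic $f:\mathbb{D}\to\mathbb{C}$ with $f(0)=0$, $f'(0)=1$; quotients $f(z)/z$ are extended by their limit at $0$. $\mathcal{G}_0=\{f\in\mathcal{A}:\operatorname{Re}(f(z)/z)>0,\ z\in\mathbb{D}\}$. For $\alpha\le1$, $$\mathfrak{A}^1_\alpha=\left\{f\in\mathcal{A}:\ \left|\alpha\frac{f(z)}{z}+(1-\alpha)f'(z)-1\right|\le2-\alpha,\ z\in\mathbb{D}\right\}.$$ A filtration of $\mathcal{G}_0$ (indexed by a connected $J\subset\mathbb{R}$) is a family $\{\mathfrak{F}_s\}_{s\in J}$ of subsets of $\mathcal{G}_0$ with $\mathfrak{F}_s\subseteq\mathfrak{F}_t$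 for $s\le t$. It is strict if $\mathfrak{F}_s\subsetneq\mathfrak{F}_t$ for $s<t$. The boundary is $\partial\mathfrak{F}_t=\mathfrak{F}_t\setminus\bigcup_{s\in J,\,s<t}\mathfrak{F}_s$. A function $f_*\in\mathcal{F}\subset\mathcal{A}$ is totally extremal for $\mathcal{F}$ if for all $c\in\mathbb{C}$, $r\in[0,1)$ and $f\in\mathcal{F}$: $\min_{|z|=r}\operatorname{Re}\left(c\frac{f(z)}{z}\right)\ge\min_{|z|=r}\operatorname{Re}\left(c\frac{f_*(z)}{z}\right)$. For $\mathcal{G}_1\subseteq\mathcal{G}_0$: $K(\mathcal{G}_1)=\inf_{f\in\mathcal{G}_1}\inf_{z\in\mathbb{D}}\operatorname{Re}\frac{f(z)}{z}$, $B(\mathcal{G}_1)=\frac2\pi\sup_{f\in\mathcal{G}_1}\sup_{z\in\mathbb{D}}\left|\arg\frac{f(z)}{z}\right|$ (principal argument). *)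

theory Defs
  imports "HOL-Complex_Analysis.Complex_Analysis"
begin

abbreviation unit_disk :: "complex set" where
  "unit_disk \<equiv> ball 0 1"

text \<open>
  Functions on the open unit disk are represented by total functions on the complex plane.
  Every notion below depends only on the values inside the disk, so the values outside are
  immaterial and no normalisation is imposed on them.
\<close>

definition class_A :: "(complex \<Rightarrow> complex) set" where
  "class_A = {f. f holomorphic_on unit_disk \<and> f 0 = 0 \<and> deriv f 0 = 1}"

definition quot_z :: "(complex \<Rightarrow> complex) \<Rightarrow> complex \<Rightarrow> complex" where
  "quot_z f z = (if z = 0 then Lim (at 0) (\<lambda>w. f w / w) else f z / z)"

definition class_G0 :: "(complex \<Rightarrow> complex) set" where
  "class_G0 = {f \<in> class_A. \<forall>z\<in>unit_disk. Re (quot_z f z) > 0}"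

definition class_A1 :: "real \<Rightarrow> (complex \<Rightarrow> complex) set" where
  "class_A1 \<alpha> = {f \<in> class_A. \<forall>z\<in>unit_disk.
     cmod (of_real \<alpha> * quot_z f z + of_real (1 - \<alpha>) * deriv f z - 1) \<le> 2 - \<alpha>}"

definition filtration :: "real set \<Rightarrow> (real \<Rightarrow> (complex \<Rightarrow> complex) set) \<Rightarrow> bool" where
  "filtration J F \<longleftrightarrow> connected J \<and> (\<forall>s\<in>J. F s \<subseteq> class_G0) \<and>
     (\<forall>s\<in>J. \<forall>t\<in>J. s \<le> t \<longrightarrow> F s \<subseteq> F t)"

definition strict_filtration :: "real set \<Rightarrow> (real \<Rightarrow> (complex \<Rightarrow> complex) set) \<Rightarrow> bool" where
  "strict_filtration J F \<longleftrightarrow> filtration J F \<and>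
     (\<forall>s\<in>J. \<forall>t\<in>J. s < t \<longrightarrow> F s \<subset> F t)"

definition filtration_boundary ::
  "real set \<Rightarrow> (real \<Rightarrow> (complex \<Rightarrow> complex) set) \<Rightarrow> real \<Rightarrow> (complex \<Rightarrow> complex) set" where
  "filtration_boundary J F t = F t - (\<Union>s\<in>{s\<in>J. s < t}. F s)"

text \<open>
  On a circle of radius less than 1 the real part below is continuous (\<open>f \<in> class_A\<close>),
  so the infimum is an attained minimum.
\<close>

definition circle_min :: "complex \<Rightarrow> real \<Rightarrow> (complex \<Rightarrow> complex) \<Rightarrow> real" where
  "circle_min c r f = (INF z\<in>sphere 0 r. Re (c * quot_z f z))"

definition totally_extremal ::
  "(complex \<Rightarrow> complex) \<Rightarrow> (complex \<Rightarrow> complex) set \<Rightarrow> bool" where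
  "totally_extremal g F \<longleftrightarrow> F \<subseteq> class_A \<and> g \<in> F \<and>
     (\<forall>c::complex. \<forall>r\<in>{0..<1::real}. \<forall>f\<in>F. circle_min c r f \<ge> circle_min c r g)"

text \<open>
  Infima and suprema are taken in the extended reals, so that they carry no hidden
  boundedness or nonemptiness assumption.
\<close>

definition K_const :: "(complex \<Rightarrow> complex) set \<Rightarrow> ereal" where
  "K_const G = (INF f\<in>G. INF z\<in>unit_disk. ereal (Re (quot_z f z)))"

definition B_const :: "(complex \<Rightarrow> complex) set \<Rightarrow> ereal" where
  "B_const G = ereal (2 / pi) * (SUP f\<in>G. SUP z\<in>unit_disk. ereal \<bar>Arg (quot_z f z)\<bar>)"

end

theory Submission
  imports Defs
begin

text \<open>
  Put \<open>p(z) = f(z)/z - 1\<close> and \<open>\<beta> = 1 - \<alpha> \<ge> 0\<close>. The condition defining the class becomes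
  \<open>|p + \<beta> z p'| \<le> 1 + \<beta>\<close>. By the Schwarz lemma the bound improves to \<open>(1 + \<beta>) |z|\<close>, and since
  \<open>d/dt (t\<^sup>1\<^sup>/\<^sup>\<beta> p(t z)) = \<beta>\<^sup>-\<^sup>1 t\<^sup>1\<^sup>/\<^sup>\<beta>\<^sup>-\<^sup>1 (p + \<beta> z p')(t z)\<close>, the mean value inequality along the ray to \<open>z\<close>
  gives \<open>|p(z)| \<le> |z|\<close>. Everything follows from this: \<open>p + \<beta>' z p'\<close> is a convex combination of \<open>p\<close>
  and \<open>p + \<beta> z p'\<close> for \<open>\<beta>' \<le> \<beta>\<close>, and \<open>f(z)/z\<close> lies in the disk about 1 of radius \<open>|z|\<close>, which the
  extremal functions fill. Strictness holds because \<open>(1 + n \<beta>) / (1 + \<beta>)\<close> is strictly increasing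
  in \<open>\<beta>\<close> for \<open>n \<ge> 2\<close>.
\<close>

section \<open>Growth estimate for a solution of \<open>p + \<beta> z p' = h\<close>\<close>

text \<open>The Schwarz lemma wants a strict bound by 1, while here the bound is weak and M may be
  0. So h is divided by an arbitrary N > M, and then N tends to M from the right.\<close>

lemma Schwarz_bound:
  assumes "h holomorphic_on unit_disk" "h 0 = 0" "z \<in> unit_disk"
    and bd: "\<And>w. w \<in> unit_disk \<Longrightarrow> cmod (h w) \<le> M"
  shows "cmod (h z) \<le> M * cmod z"
proof -
  have M0: "0 \<le> M" using bd[of 0] assms(2) by simp
  have *: "cmod (h z) \<le> N * cmod z" if "M < N" for N
  proof -
    have N: "N > 0" using M0 that by linarith
    have "cmod (h z / of_real N) \<le> cmod z"
    proof (rule Schwarz_Lemma(1)[of "\<lambda>w. h w / of_real N"])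
      show "(\<lambda>w. h w / of_real N) holomorphic_on unit_disk"
        using N by (intro holomorphic_intros assms) auto
      show "cmod (h w / of_real N) < 1" if "cmod w < 1" for w
        using bd[of w] that \<open>M < N\<close> N by (simp add: norm_divide)
    qed (use assms in auto)
    then show ?thesis using N by (simp add: norm_divide field_simps)
  qed
  have "\<forall>\<^sub>F N in at_right M. cmod (h z) \<le> N * cmod z"
    using * by (auto simp: eventually_at_right_less eventually_at_filter)
  moreover have "((\<lambda>N. N * cmod z) \<longlongrightarrow> M * cmod z) (at_right M)"
    by (intro tendsto_intros)
  ultimately show ?thesis
    using tendsto_lowerbound[of "\<lambda>N. N * cmod z"] trivial_limit_at_right_real by blast
qed

lemma cmod_le_if_linear_combination_le:
  fixes p :: "complex \<Rightarrow> complex" and \<beta> :: real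
  assumes hol: "p holomorphic_on unit_disk" and p0: "p 0 = 0" and \<beta>: "\<beta> \<ge> 0"
    and z: "z \<in> unit_disk"
    and bd: "\<And>w. w \<in> unit_disk \<Longrightarrow> cmod (p w + of_real \<beta> * (w * deriv p w)) \<le> 1 + \<beta>"
  shows "cmod (p z) \<le> cmod z"
proof -
  define h where "h w = p w + of_real \<beta> * (w * deriv p w)" for w
  have h: "h holomorphic_on unit_disk"
    unfolding h_def by (intro holomorphic_intros hol holomorphic_deriv) auto
  have hb: "cmod (h w) \<le> (1 + \<beta>) * cmod w" if "w \<in> unit_disk" for w
    by (rule Schwarz_bound[OF h _ that]) (use bd p0 in \<open>auto simp: h_def\<close>)
  show ?thesis
  \<comment> \<open>For \<beta> = 0 there is no exponent 1/\<beta>, but then h is p itself and the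
    Schwarz bound is already the claim.\<close>
  proof (cases "\<beta> = 0")
    case True
    then show ?thesis using hb[OF z] by (simp add: h_def)
  next
    case False
    with \<beta> have b: "\<beta> > 0" by simp
    define k where "k = 1 / \<beta>"
    have k: "k > 0" using b by (simp add: k_def)
    have tz: "of_real t * z \<in> unit_disk" if "0 \<le> t" "t \<le> 1" for t
    proof -
      have "t * cmod z \<le> cmod z" using that by (simp add: mult_left_le_one_le)
      then show ?thesis using that z by (simp add: norm_mult)
    qed
    \<comment> \<open>The power of t is the integrating factor. At t = 0 the product vanishes, so
      \<open>F 1 - F 0\<close> is \<open>p z\<close>.\<close>
    define F where "F t = of_real (t powr k) * p (of_real t * z)" for t :: real
    define F' where "F' t = of_real (k * t powr (k - 1)) * h (of_real t * z)" for t :: real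
    \<comment> \<open>A primitive of the Schwarz bound for \<open>F'\<close>: since k (1 + \<beta>)
      = k + 1, that bound is exactly \<open>\<phi>'\<close>, and the increment of \<phi> over [0, 1]
      is |z|.\<close>
    define \<phi> where "\<phi> t = t powr (k + 1) * cmod z" for t :: real
    define \<phi>' where "\<phi>' t = (k + 1) * t powr k * cmod z" for t :: real
    have "norm (F 1 - F 0) \<le> \<phi> 1 - \<phi> 0"
    \<comment> \<open>This mean value inequality asks for derivatives only in the open interval,
      which matters because \<open>t powr (k - 1)\<close> is singular at 0 when \<beta> > 1.\<close>
    proof (rule differentiable_bound_general[of 0 1 F \<phi> F' \<phi>'])
      show "continuous_on {0..1} F"
        unfolding F_def
        by (intro continuous_intros continuous_on_powr'
            continuous_on_compose2[OF holomorphic_on_imp_continuous_on[OF hol]])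
           (use k tz in auto)
      show "continuous_on {0..1} \<phi>"
        unfolding \<phi>_def by (intro continuous_intros continuous_on_powr') (use k in auto)
      fix t :: real assume t: "0 < t" "t < 1"
      have tk: "t powr k = t * t powr (k - 1)"
        using t by (simp add: powr_diff)
      show "(\<phi> has_vector_derivative \<phi>' t) (at t)"
        unfolding \<phi>_def \<phi>'_def has_real_derivative_iff_has_vector_derivative[symmetric]
        using t by (auto intro!: derivative_eq_intros)
      have dp: "(p has_field_derivative deriv p (of_real t * z)) (at (of_real t * z))"
        using holomorphic_derivI[OF hol open_ball tz] t by simp
      have "((\<lambda>s. of_real s * z) has_vector_derivative z) (at t)"
        by (auto intro!: derivative_eq_intros)
      from field_vector_diff_chain_at[OF this dp]
      have "((\<lambda>s. p (of_real s * z)) has_vector_derivative z * deriv p (of_real t * z)) (at t)" by (simp add: o_def)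
      moreover have "((\<lambda>s. complex_of_real (s powr k)) has_vector_derivative of_real (k * t powr (k - 1))) (at t)"
        using t by (intro has_vector_derivative_of_real) (auto intro!: derivative_eq_intros)
      ultimately have "(F has_vector_derivative
          (of_real (t powr k) * (z * deriv p (of_real t * z)) + of_real (k * t powr (k - 1)) * p (of_real t * z))) (at t)"
        unfolding F_def by (intro has_vector_derivative_mult)
      also have "of_real (t powr k) * (z * deriv p (of_real t * z)) + of_real (k * t powr (k - 1)) * p (of_real t * z) = F' t"
        unfolding F'_def h_def tk unfolding k_def using b by (simp add: field_simps)
      finally show "(F has_vector_derivative F' t) (at t)" .
      have "norm (F' t) \<le> k * t powr (k - 1) * ((1 + \<beta>) * (t * cmod z))"
        using hb[OF tz, of t] t k unfolding F'_def
        by (auto simp: norm_mult abs_mult intro!: mult_left_mono)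
      also have "\<dots> = \<phi>' t"
        unfolding \<phi>'_def tk using b by (simp add: k_def field_simps)
      finally show "norm (F' t) \<le> \<phi>' t" .
    qed simp
    then show ?thesis by (simp add: F_def \<phi>_def)
  qed
qed

section \<open>The quotient f(z)/z and the class in terms of it\<close>

lemma quot_z_eq:
  assumes "f \<in> class_A"
  shows "quot_z f z = (if z = 0 then 1 else f z / z)"
proof (cases "z = 0")
  case True
  have "f holomorphic_on unit_disk" "f 0 = 0" "deriv f 0 = 1"
    using assms by (auto simp: class_A_def)
  then have "(f has_field_derivative 1) (at 0)"
    using holomorphic_derivI[of f unit_disk 0] by simp
  then have "((\<lambda>w. f w / w) \<longlongrightarrow> 1) (at 0)"
    using \<open>f 0 = 0\<close> by (simp add: has_field_derivative_iff)
  then have "Lim (at 0) (\<lambda>w. f w / w) = 1" by (intro tendsto_Lim) auto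
  then show ?thesis using True by (simp add: quot_z_def)
qed (simp add: quot_z_def)

text \<open>The singularity at 0 is removable: the quotient is the difference quotient of f at 0,
  completed there by f'(0) = 1.\<close>

lemma quot_z_holomorphic:
  assumes "f \<in> class_A"
  shows "quot_z f holomorphic_on unit_disk"
proof -
  have f: "f holomorphic_on unit_disk" "f 0 = 0" "deriv f 0 = 1"
    using assms by (auto simp: class_A_def)
  have "(\<lambda>z. if z = 0 then deriv f 0 else (f z - f 0) / (z - 0)) holomorphic_on unit_disk"
    by (rule pole_lemma) (use f in auto)
  then show ?thesis
    by (rule holomorphic_transform) (use f quot_z_eq[OF assms] in auto)
qed

lemma deriv_eq_quot_z:
  assumes "f \<in> class_A" "z \<in> unit_disk"
  shows "deriv f z = quot_z f z + z * deriv (quot_z f) z"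
proof -
  have "((\<lambda>w. w * quot_z f w) has_field_derivative quot_z f z + z * deriv (quot_z f) z) (at z)"
    by (auto intro!: derivative_eq_intros
        holomorphic_derivI[OF quot_z_holomorphic[OF assms(1)] open_ball assms(2)])
  moreover have "(\<lambda>w. w * quot_z f w) = f"
    using assms(1) by (auto simp: quot_z_eq[OF assms(1)] class_A_def)
  ultimately show ?thesis by (simp add: DERIV_imp_deriv)
qed

text \<open>Differentiating f(z) = z q(z) turns the defining expression into p + (1 - \<alpha>) z p'
  with p = q - 1, the form that the growth estimate handles.\<close>

lemma class_A1_iff:
  "f \<in> class_A1 \<alpha> \<longleftrightarrow> f \<in> class_A \<and> (\<forall>z\<in>unit_disk.
     cmod (quot_z f z - 1 + of_real (1 - \<alpha>) * (z * deriv (quot_z f) z)) \<le> 2 - \<alpha>)"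
proof -
  have *: "of_real \<alpha> * quot_z f z + of_real (1 - \<alpha>) * deriv f z - 1 =
      quot_z f z - 1 + of_real (1 - \<alpha>) * (z * deriv (quot_z f) z)"
    if "f \<in> class_A" "z \<in> unit_disk" for z
    unfolding deriv_eq_quot_z[OF that] by (simp add: algebra_simps)
  show ?thesis
    unfolding class_A1_def mem_Collect_eq by (intro conj_cong ball_cong refl) (simp only: *)
qed

lemma cmod_quot_z_minus_1_le:
  assumes "f \<in> class_A1 \<alpha>" "\<alpha> \<le> 1" "z \<in> unit_disk"
  shows "cmod (quot_z f z - 1) \<le> cmod z"
proof (rule cmod_le_if_linear_combination_le[where \<beta> = "1 - \<alpha>"])
  have f: "f \<in> class_A" using assms by (simp add: class_A1_def)
  show "(\<lambda>z. quot_z f z - 1) holomorphic_on unit_disk"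
    by (intro holomorphic_intros quot_z_holomorphic f)
  show "quot_z f 0 - 1 = 0" using quot_z_eq[OF f] by simp
  fix w :: complex assume w: "w \<in> unit_disk"
  have "deriv (\<lambda>z. quot_z f z - 1) w = deriv (quot_z f) w"
    using holomorphic_derivI[OF quot_z_holomorphic[OF f] open_ball w]
    by (auto intro!: DERIV_imp_deriv derivative_eq_intros)
  then show "cmod (quot_z f w - 1 + of_real (1 - \<alpha>) * (w * deriv (\<lambda>z. quot_z f z - 1) w)) \<le> 1 + (1 - \<alpha>)"
    using assms(1) w by (auto simp: class_A1_iff)
qed (use assms in auto)

text \<open>A disk about 1 of radius |z| < 1 stays in the open right half-plane.\<close>

lemma Re_quot_z_pos:
  assumes "f \<in> class_A1 \<alpha>" "\<alpha> \<le> 1" "z \<in> unit_disk"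
  shows "Re (quot_z f z) > 0"
  using cmod_quot_z_minus_1_le[OF assms] abs_Re_le_cmod[of "quot_z f z - 1"] assms(3) by auto

section \<open>Monotonicity in \<alpha>\<close>

lemma filtration_class_A1: "filtration {..1} class_A1"
proof -
  have "class_A1 s \<subseteq> class_G0" if "s \<le> 1" for s
    using that Re_quot_z_pos by (auto simp: class_G0_def class_A1_def)
  moreover have "class_A1 s \<subseteq> class_A1 t" if st: "s \<le> t" "t \<le> 1" for s t
  proof (cases "s = t")
    case False
    with st have "s < 1" by simp
    show ?thesis
    proof
      fix f assume f: "f \<in> class_A1 s"
      \<comment> \<open>The weight of the convex combination. The resulting bound is (1 - c) + c (2
        - s) = 1 + c (1 - s) = 2 - t.\<close>
      define c where "c = (1 - t) / (1 - s)"
      have c: "0 \<le> c" "c \<le> 1" "1 - t = c * (1 - s)" using st \<open>s < 1\<close> by (auto simp: c_def)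
      have "cmod (quot_z f z - 1 + of_real (1 - t) * (z * deriv (quot_z f) z)) \<le> 2 - t"
        if z: "z \<in> unit_disk" for z
      proof -
        define p where "p = quot_z f z - 1"
        define d where "d = z * deriv (quot_z f) z"
        have "p + of_real (1 - t) * d = of_real (1 - c) * p + of_real c * (p + of_real (1 - s) * d)"
          unfolding c(3) by (simp add: algebra_simps)
        also have "cmod \<dots> \<le> (1 - c) * cmod p + c * cmod (p + of_real (1 - s) * d)"
          using norm_triangle_ineq[of "of_real (1 - c) * p" "of_real c * (p + of_real (1 - s) * d)"] c
          unfolding norm_mult norm_of_real by simp
        also have "\<dots> \<le> (1 - c) * 1 + c * (2 - s)"
          using cmod_quot_z_minus_1_le[OF f _ z] st f z c
          by (intro add_mono mult_left_mono) (auto simp: p_def d_def class_A1_iff)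
        also have "\<dots> = 2 - t" using c(3) by (simp add: algebra_simps)
        finally show ?thesis by (simp add: p_def d_def)
      qed
      then show "f \<in> class_A1 t" using f by (auto simp: class_A1_iff)
    qed
  qed simp
  ultimately show ?thesis
    by (auto simp: filtration_def)
qed

section \<open>Membership of the functions z + a z^(n+1)\<close>

lemma monomial_perturbation:
  assumes "n \<ge> 1"
  shows monomial_perturbation_class_A: "(\<lambda>z. z + a * z ^ (n + 1)) \<in> class_A"
    and quot_z_monomial_perturbation: "quot_z (\<lambda>z. z + a * z ^ (n + 1)) = (\<lambda>z. 1 + a * z ^ n)"
proof -
  have "((\<lambda>z. z + a * z ^ (n + 1)) has_field_derivative 1) (at 0)"
    using assms by (auto intro!: derivative_eq_intros)
  then show A: "(\<lambda>z. z + a * z ^ (n + 1)) \<in> class_A"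
    by (auto simp: class_A_def DERIV_imp_deriv intro!: holomorphic_intros)
  show "quot_z (\<lambda>z. z + a * z ^ (n + 1)) = (\<lambda>z. 1 + a * z ^ n)"
    unfolding quot_z_eq[OF A] using assms by (auto simp: fun_eq_iff field_simps)
qed

text \<open>Since z^n is an eigenfunction of z d/dz with eigenvalue n, the defining expression has
  modulus exactly \<open>C * cmod z ^ n\<close>. Its supremum C over the disk is approached as |z|
  tends to 1, so the criterion is sharp; this sharpness later excludes functions from smaller
  classes.\<close>

lemma monomial_perturbation_class_A1_iff:
  assumes n: "n \<ge> 1" and \<alpha>: "\<alpha> \<le> 1"
  shows "(\<lambda>z. z + a * z ^ (n + 1)) \<in> class_A1 \<alpha> \<longleftrightarrow> cmod a * (1 + real n * (1 - \<alpha>)) \<le> 2 - \<alpha>"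
proof -
  define C where "C = cmod a * (1 + real n * (1 - \<alpha>))"
  have C0: "C \<ge> 0" using \<alpha> by (simp add: C_def)
  have eq: "cmod (1 + a * z ^ n - 1 + of_real (1 - \<alpha>) * (z * deriv (\<lambda>z. 1 + a * z ^ n) z)) = C * cmod z ^ n" for z
  proof -
    have d: "deriv (\<lambda>z. 1 + a * z ^ n) z = a * (of_nat n * z ^ (n - 1))"
      by (rule DERIV_imp_deriv) (auto intro!: derivative_eq_intros)
    have "z * (a * (of_nat n * z ^ (n - 1))) = a * of_nat n * z ^ n"
      using n by (cases n) auto
    then have "1 + a * z ^ n - 1 + of_real (1 - \<alpha>) * (z * deriv (\<lambda>z. 1 + a * z ^ n) z)
        = a * z ^ n + of_real (1 - \<alpha>) * (a * of_nat n * z ^ n)"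
      unfolding d by simp
    also have "\<dots> = a * of_real (1 + real n * (1 - \<alpha>)) * z ^ n"
      by (simp add: algebra_simps)
    finally have "1 + a * z ^ n - 1 + of_real (1 - \<alpha>) * (z * deriv (\<lambda>z. 1 + a * z ^ n) z)
        = a * of_real (1 + real n * (1 - \<alpha>)) * z ^ n" .
    then show ?thesis
      using \<alpha> by (simp add: C_def norm_mult norm_power del: of_real_add of_real_mult of_real_diff)
  qed
  have "(\<lambda>z. z + a * z ^ (n + 1)) \<in> class_A1 \<alpha> \<longleftrightarrow> (\<forall>z\<in>unit_disk. C * cmod z ^ n \<le> 2 - \<alpha>)"
    unfolding class_A1_iff quot_z_monomial_perturbation[OF n] eq
    using monomial_perturbation_class_A[OF n] by auto
  also have "\<dots> \<longleftrightarrow> C \<le> 2 - \<alpha>"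
  proof
    assume L: "\<forall>z\<in>unit_disk. C * cmod z ^ n \<le> 2 - \<alpha>"
    have "C * x ^ n \<le> 2 - \<alpha>" if "0 < x" "x < 1" for x :: real
      using L[rule_format, of "of_real x"] that by simp
    then have "\<forall>\<^sub>F x in at_left 1. C * x ^ n \<le> 2 - \<alpha>"
      using eventually_at_left_real[of 0 "1::real"] by (auto elim: eventually_mono)
    moreover have "((\<lambda>x::real. C * x ^ n) \<longlongrightarrow> C * 1 ^ n) (at_left 1)"
      by (intro tendsto_intros)
    ultimately show "C \<le> 2 - \<alpha>"
      using tendsto_upperbound[of "\<lambda>x. C * x ^ n" "C * 1 ^ n" "at_left 1"] by simp
  next
    assume "C \<le> 2 - \<alpha>"
    moreover have "C * cmod z ^ n \<le> C" if "z \<in> unit_disk" for z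
      using that C0 by (simp add: mult_left_le power_le_one)
    ultimately show "\<forall>z\<in>unit_disk. C * cmod z ^ n \<le> 2 - \<alpha>" by force
  qed
  finally show ?thesis by (simp add: C_def)
qed

text \<open>For n = 1 the factor 1 + n (1 - \<alpha>) equals 2 - \<alpha>, so the criterion is |a|
  \<le> 1 for every \<alpha>.\<close>

lemma quadratic_class_A1:
  assumes "\<alpha> \<le> 1" "cmod u = 1"
  shows "(\<lambda>z. z + u * z ^ 2) \<in> class_A1 \<alpha>"
  using monomial_perturbation_class_A1_iff[of 1 \<alpha> u] assms by (simp add: numeral_2_eq_2)

lemma quot_z_quadratic: "quot_z (\<lambda>z. z + u * z ^ 2) = (\<lambda>z. 1 + u * z)"
  using quot_z_monomial_perturbation[of 1 u] by (simp add: numeral_2_eq_2)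

section \<open>Total extremality\<close>

lemma totally_extremal_quadratic:
  assumes \<alpha>: "\<alpha> \<le> 1" and u: "cmod u = 1"
  shows "totally_extremal (\<lambda>z. z + u * z ^ 2) (class_A1 \<alpha>)"
  unfolding totally_extremal_def
proof (intro conjI allI ballI)
  show "class_A1 \<alpha> \<subseteq> class_A" by (auto simp: class_A1_def)
  show "(\<lambda>z. z + u * z ^ 2) \<in> class_A1 \<alpha>" using quadratic_class_A1 assms .
  fix c :: complex and r :: real and f
  assume r: "r \<in> {0..<1}" and f: "f \<in> class_A1 \<alpha>"
  have lb: "Re c - cmod c * r \<le> Re (c * quot_z g z)" if "g \<in> class_A1 \<alpha>" "z \<in> sphere 0 r" for g z
  proof -
    have "cmod (c * (quot_z g z - 1)) \<le> cmod c * r"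
      using cmod_quot_z_minus_1_le[OF that(1) \<alpha>, of z] that r
      by (auto simp: norm_mult intro!: mult_left_mono)
    then show ?thesis
      using abs_Re_le_cmod[of "c * (quot_z g z - 1)"] by (auto simp: algebra_simps)
  qed
  \<comment> \<open>Chosen so that c u z = -|c| r, where the lower bound \<open>lb\<close> is
    attained. For c = 0 the quotient would be 0 by the division convention and could miss the
    circle, so any point of modulus r is taken.\<close>
  define z where "z = (if c = 0 then of_real r else - (of_real (cmod c * r) / (c * u)))"
  have z: "z \<in> sphere 0 r" using r u by (auto simp: z_def norm_mult norm_divide)
  have u0: "u \<noteq> 0" using u by auto
  have "circle_min c r (\<lambda>z. z + u * z ^ 2) \<le> Re (c * quot_z (\<lambda>z. z + u * z ^ 2) z)"
    unfolding circle_min_def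
    by (rule cINF_lower[OF _ z]) (intro bdd_belowI2[where m = "Re c - cmod c * r"] lb quadratic_class_A1 assms)
  also have "c * quot_z (\<lambda>z. z + u * z ^ 2) z = c - of_real (cmod c * r)"
    unfolding quot_z_quadratic z_def using u0 by (simp add: field_simps)
  also have "Re \<dots> \<le> circle_min c r f"
    unfolding circle_min_def by (rule cINF_greatest) (use z lb[OF f] in auto)
  finally show "circle_min c r (\<lambda>z. z + u * z ^ 2) \<le> circle_min c r f" .
qed

section \<open>Boundary functions and strictness\<close>

lemma monomial_perturbation_boundary:
  assumes \<alpha>: "\<alpha> \<le> 1" and n: "n \<ge> 2" and a: "cmod a = (2 - \<alpha>) / (1 + real n * (1 - \<alpha>))"
  shows "(\<lambda>z. z + a * z ^ (n + 1)) \<in> filtration_boundary {..1} class_A1 \<alpha>"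
proof -
  have pos: "1 + real n * (1 - \<alpha>) > 0" using \<alpha> by (intro add_pos_nonneg) auto
  have "(\<lambda>z. z + a * z ^ (n + 1)) \<in> class_A1 \<alpha>"
    using monomial_perturbation_class_A1_iff[of n \<alpha> a] n \<alpha> a pos by simp
  moreover have "(\<lambda>z. z + a * z ^ (n + 1)) \<notin> class_A1 s" if s: "s < \<alpha>" for s
  proof
    assume "(\<lambda>z. z + a * z ^ (n + 1)) \<in> class_A1 s"
    then have "(2 - \<alpha>) / (1 + real n * (1 - \<alpha>)) * (1 + real n * (1 - s)) \<le> 2 - s"
      using monomial_perturbation_class_A1_iff[of n s a] n \<alpha> a s by simp
    then have "(2 - \<alpha>) * (1 + real n * (1 - s)) \<le> (2 - s) * (1 + real n * (1 - \<alpha>))"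
      using pos by (simp add: field_simps)
    \<comment> \<open>This is the difference of the two sides, the products (1 - \<alpha>) (1 - s)
      having cancelled. It is positive only because n exceeds 1.\<close>
    then have "(real n - 1) * (\<alpha> - s) \<le> 0" by (simp add: algebra_simps)
    moreover have "(real n - 1) * (\<alpha> - s) > 0" using n s by simp
    ultimately show False by simp
  qed
  ultimately show ?thesis by (auto simp: filtration_boundary_def)
qed

lemma strict_filtration_class_A1: "strict_filtration {..1} class_A1"
  unfolding strict_filtration_def
proof (intro conjI ballI impI filtration_class_A1)
  fix s t :: real assume st: "s \<in> {..1}" "t \<in> {..1}" "s < t"
  have "class_A1 s \<subseteq> class_A1 t" using filtration_class_A1 st by (auto simp: filtration_def)
  moreover
  \<comment> \<open>The boundary function of index t with n = 2 and \<theta> = 0 separates the two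
    classes.\<close>
  define f where "f = (\<lambda>z. z + complex_of_real ((2 - t) / (1 + real 2 * (1 - t))) * z ^ (2 + 1))"
  have "f \<in> filtration_boundary {..1} class_A1 t"
    unfolding f_def by (rule monomial_perturbation_boundary) (use st in \<open>auto simp del: of_real_divide\<close>)
  then have "f \<in> class_A1 t" "f \<notin> class_A1 s" using st by (auto simp: filtration_boundary_def)
  ultimately show "class_A1 s \<subset> class_A1 t" by blast
qed

section \<open>The constants K and B\<close>

lemma K_const_class_A1:
  assumes "\<alpha> \<le> 1"
  shows "K_const (class_A1 \<alpha>) = 0"
proof (rule antisym)
  show "0 \<le> K_const (class_A1 \<alpha>)"
    unfolding K_const_def using Re_quot_z_pos[OF _ assms] by (intro INF_greatest) (simp add: less_imp_le)
  show "K_const (class_A1 \<alpha>) \<le> 0"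
  proof (rule ereal_le_epsilon2)
    fix e :: real assume e: "0 < e"
    \<comment> \<open>The quotient 1 + z of z + z^2 tends to 0 as z tends to -1 along the real axis.
      Capping e at 1 keeps z in the disk.\<close>
    define z where "z = complex_of_real (min e 1 / 2 - 1)"
    have "cmod z = \<bar>min e 1 / 2 - 1\<bar>" unfolding z_def by (rule norm_of_real)
    then have z: "z \<in> unit_disk" using e by (auto simp: min_def)
    have "K_const (class_A1 \<alpha>) \<le> ereal (Re (quot_z (\<lambda>z. z + 1 * z ^ 2) z))"
      unfolding K_const_def
      by (rule INF_lower2[OF quadratic_class_A1[OF assms] INF_lower[OF z]]) simp
    also have "\<dots> \<le> 0 + ereal e"
      unfolding quot_z_quadratic z_def using e by (simp add: min_def)
    finally show "K_const (class_A1 \<alpha>) \<le> 0 + ereal e" .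
  qed
qed

lemma B_const_class_A1:
  assumes "\<alpha> \<le> 1"
  shows "B_const (class_A1 \<alpha>) = 1"
proof -
  define S where "S = (SUP f\<in>class_A1 \<alpha>. SUP z\<in>unit_disk. ereal \<bar>Arg (quot_z f z)\<bar>)"
  have "S = ereal (pi / 2)"
  proof (rule antisym)
    have "\<bar>Arg (quot_z f z)\<bar> \<le> pi / 2" if "f \<in> class_A1 \<alpha>" "z \<in> unit_disk" for f z
    proof -
      have "quot_z f z \<noteq> 0" using Re_quot_z_pos[OF that(1) assms that(2)] by auto
      then show ?thesis using Arg_Re_nonneg[of "quot_z f z"] Re_quot_z_pos[OF that(1) assms that(2)] by simp
    qed
    then show "S \<le> ereal (pi / 2)" unfolding S_def by (intro SUP_least) simp
    \<comment> \<open>The quotient 1 + z of z + z^2 fills the open unit disk about 1, which contains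
      points of every argument x in (0, pi/2).\<close>
    have phi: "ereal x \<le> S" if x: "0 < x" "x < pi / 2" for x
    proof -
      \<comment> \<open>the circle with diameter \<open>[0, 1]\<close> in polar coordinates\<close>
      define w where "w = of_real (cos x) * cis x"
      have c: "0 < cos x" "cos x < 1" using x cos_gt_zero cos_monotone_0_pi[of 0 x] by auto
      have "(cmod (w - 1))\<^sup>2 = (cos x * cos x - 1)\<^sup>2 + (cos x * sin x)\<^sup>2"
        by (simp add: w_def cmod_power2)
      also have "\<dots> = 1 - (cos x)\<^sup>2"
        using sin_cos_squared_add[of x] by (simp add: power2_eq_square) algebra
      also have "\<dots> < 1" using c by simp
      finally have "cmod (w - 1) < 1" by (simp add: power_less_one_iff abs_square_less_1)
      then have z: "w - 1 \<in> unit_disk" by simp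
      have "Arg w = x" using c x by (simp add: w_def Arg_times_of_real2 Arg_cis)
      then have "ereal x = ereal \<bar>Arg (quot_z (\<lambda>z. z + 1 * z ^ 2) (w - 1))\<bar>"
        unfolding quot_z_quadratic using x by simp
      also have "\<dots> \<le> S"
        unfolding S_def
        by (rule SUP_upper2[OF quadratic_class_A1[OF assms] SUP_upper[OF z]]) simp
      finally show ?thesis .
    qed
    show "ereal (pi / 2) \<le> S"
    proof (rule ereal_le_epsilon2)
      fix e :: real assume e: "0 < e"
      \<comment> \<open>The maximum with pi/4 keeps x positive when e is large.\<close>
      define x where "x = max (pi / 4) (pi / 2 - e)"
      have "ereal (pi / 2) \<le> ereal x + ereal e" by (simp add: x_def max_def)
      also have "\<dots> \<le> S + ereal e"
        by (intro add_right_mono phi) (use e in \<open>auto simp: x_def max_def\<close>)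
      finally show "ereal (pi / 2) \<le> S + ereal e" .
    qed
  qed
  then show ?thesis by (simp add: B_const_def S_def one_ereal_def)
qed

theorem theorem5p14:
  shows "filtration {..1} class_A1 \<and>
    (\<forall>\<alpha>\<le>1.
       (\<forall>\<theta>::real.
          (\<lambda>z. z + exp (\<i> * of_real \<theta>) * z ^ 2) \<in> class_A1 \<alpha> \<and>
          totally_extremal (\<lambda>z. z + exp (\<i> * of_real \<theta>) * z ^ 2) (class_A1 \<alpha>)) \<and>
       (\<forall>(\<theta>::real) (n::nat). n \<ge> 2 \<longrightarrow>
          (\<lambda>z. z + of_real ((2 - \<alpha>) / (1 + real n * (1 - \<alpha>))) *
                 exp (\<i> * of_real \<theta>) * z ^ (n + 1))
            \<in> filtration_boundary {..1} class_A1 \<alpha>) \<and>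
       K_const (class_A1 \<alpha>) = 0 \<and> B_const (class_A1 \<alpha>) = 1) \<and>
    strict_filtration {..1} class_A1"
proof (intro conjI allI impI)
  show "filtration {..1} class_A1" by (rule filtration_class_A1)
  show "strict_filtration {..1} class_A1" by (rule strict_filtration_class_A1)
  fix \<alpha> :: real assume \<alpha>: "\<alpha> \<le> 1"
  show "K_const (class_A1 \<alpha>) = 0" using K_const_class_A1[OF \<alpha>] .
  show "B_const (class_A1 \<alpha>) = 1" using B_const_class_A1[OF \<alpha>] .
  fix \<theta> :: real
  show "(\<lambda>z. z + exp (\<i> * of_real \<theta>) * z ^ 2) \<in> class_A1 \<alpha>"
    by (rule quadratic_class_A1[OF \<alpha>]) simp
  show "totally_extremal (\<lambda>z. z + exp (\<i> * of_real \<theta>) * z ^ 2) (class_A1 \<alpha>)"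
    by (rule totally_extremal_quadratic[OF \<alpha>]) simp
  fix n :: nat assume n: "n \<ge> 2"
  have "cmod (of_real ((2 - \<alpha>) / (1 + real n * (1 - \<alpha>))) * exp (\<i> * of_real \<theta>)) =
      (2 - \<alpha>) / (1 + real n * (1 - \<alpha>))"
    unfolding norm_mult norm_of_real using \<alpha> by simp
  then show "(\<lambda>z. z + of_real ((2 - \<alpha>) / (1 + real n * (1 - \<alpha>))) * exp (\<i> * of_real \<theta>) * z ^ (n + 1))
      \<in> filtration_boundary {..1} class_A1 \<alpha>"
    by (rule monomial_perturbation_boundary[OF \<alpha> n])
qed

end
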